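(* Let $(H;\langle\cdot,\cdot\rangle)$ be an inner product space over $\mathbb{K}$ ($\mathbb{K}=\mathbb{C}$ or $\mathbb{R}$). If $\gamma,\Gamma\in\mathbb{K}$, $e,x,y\in H$ with $\|e\|=1$ and $\lambda\in(0,1)$ are such that $$\operatorname{Re}\langle\Gamma e-(\lambda x+(1-\lambda)y),\,(\lambda x+(1-\lambda)y)-\gamma e\rangle\ge 0,$$ or, equivalently, $$\left\|\lambda x+(1-\lambda)y-\frac{\gamma+\Gamma}{2}e\right\|\le\frac12|\Gamma-\gamma|,$$ then $$\operatorname{Re}\left[\langle x,y\rangle-\langle x,e\rangle\langle e,y\rangle\right]\le\frac1{16}\cdot\frac1{\lambda(1-\lambda)}|\Gamma-\gamma|^2.$$ The constant $\frac1{16}$ is the best possible constant in this inequality in the sense that it cannot be replaced by a smaller one (i.e. no constant smaller than $\frac1{16}$ makes the inequality valid for all such inner product spaces, vectors, scalars and $\lambda\in(0,1)$).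
   Context: The inner product is linear in the first argument and conjugate-linear in the second; $\|\cdot\|$ is the norm induced by the inner product. *)

theory Defs
  imports "HOL-Analysis.Product_Vector" "HOL-Analysis.Inner_Product"
begin

text \<open>
  Scalar fields \<open>K = \<real>\<close> or \<open>K = \<complex>\<close>: the map \<open>to_complex\<close> identifies the field, as a
  normed real algebra, with one of the subfields \<open>\<real>\<close> and \<open>\<complex>\<close> of the complex numbers.
  Compatibility with \<open>scaleR\<close> excludes discontinuous automorphisms of \<open>\<complex>\<close>.
\<close>

class real_or_complex = real_normed_field +
  fixes to_complex :: "'a \<Rightarrow> complex"
  assumes to_complex_add: "to_complex (a + b) = to_complex a + to_complex b"
    and to_complex_mult: "to_complex (a * b) = to_complex a * to_complex b"
    and to_complex_one: "to_complex 1 = 1"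
    and to_complex_scaleR: "to_complex (r *\<^sub>R a) = r *\<^sub>R to_complex a"
    and norm_to_complex: "norm (to_complex a) = norm a"
    and range_to_complex: "range to_complex = \<real> \<or> range to_complex = UNIV"

instantiation real :: real_or_complex
begin

definition to_complex_real_def: "to_complex = complex_of_real"

instance
  by standard (auto simp: to_complex_real_def Reals_def scaleR_conv_of_real)

end

instantiation complex :: real_or_complex
begin

definition to_complex_complex_def: "to_complex = (\<lambda>z::complex. z)"

instance
  by standard (auto simp: to_complex_complex_def)

end

abbreviation re :: "'k::real_or_complex \<Rightarrow> real"
  where "re a \<equiv> Re (to_complex a)"

text \<open>
  Linear in the first argument; conjugate-linearity in the second follows from
  \<open>conj_sym\<close>, which also makes \<open>ip x x\<close> real.
\<close>

locale inner_product_space = vector_space scale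
  for scale :: "'k::real_or_complex \<Rightarrow> 'a::ab_group_add \<Rightarrow> 'a" +
  fixes ip :: "'a \<Rightarrow> 'a \<Rightarrow> 'k"
  assumes ip_add_left: "ip (x + y) z = ip x z + ip y z"
    and ip_scale_left: "ip (scale a x) y = a * ip x y"
    and conj_sym: "to_complex (ip y x) = cnj (to_complex (ip x y))"
    and ip_nonneg: "0 \<le> re (ip x x)"
    and ip_definite: "ip x x = 0 \<longleftrightarrow> x = 0"

definition ip_norm :: "('a \<Rightarrow> 'a \<Rightarrow> 'k::real_or_complex) \<Rightarrow> 'a \<Rightarrow> real"
  where "ip_norm ip x = sqrt (re (ip x x))"

lemma inner_product_space_real_inner:
  "inner_product_space (scaleR :: real \<Rightarrow> 'a::real_inner \<Rightarrow> 'a) inner"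
  by unfold_locales
    (simp_all add: to_complex_real_def inner_add_left scaleR_right_distrib
       scaleR_left_distrib, rule inner_commute)

lemma ip_norm_real_inner: "ip_norm inner x = norm x"
  by (simp add: ip_norm_def to_complex_real_def norm_eq_sqrt_inner)

lemma inner_product_space_complex:
  "inner_product_space ((*) :: complex \<Rightarrow> complex \<Rightarrow> complex) (\<lambda>z w. z * cnj w)"
  by unfold_locales (auto simp: to_complex_complex_def algebra_simps)

end

theory Submission
  imports Defs
begin

text \<open>
  Let \<open>P u = u - \<langle>u, e\<rangle> e\<close>. Then \<open>\<langle>x, y\<rangle> - \<langle>x, e\<rangle>\<langle>e, y\<rangle> = \<langle>P x, P y\<rangle>\<close>, and for
  \<open>m = t x + (1 - t) y\<close> polarization gives
  \<open>\<parallel>P m\<parallel>\<^sup>2 - 4 t (1 - t) Re \<langle>P x, P y\<rangle> = \<parallel>P (t x - (1 - t) y)\<parallel>\<^sup>2 \<ge> 0\<close>, while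
  \<open>\<parallel>P m\<parallel> = \<parallel>P (m - c e)\<parallel> \<le> \<parallel>m - c e\<parallel>\<close> for every scalar \<open>c\<close>, in particular for
  \<open>c = (\<gamma> + \<Gamma>) / 2\<close>. Equality holds in the plane for \<open>e = (1, 0)\<close>, \<open>x = y = (0, 1)\<close>,
  \<open>\<Gamma> = - \<gamma> = 1\<close>, \<open>t = 1 / 2\<close>.
\<close>

lemma to_complex_0 [simp]: "to_complex 0 = 0"
  using to_complex_add[of 0 0] by simp

lemma to_complex_minus: "to_complex (- a) = - to_complex a"
  using to_complex_add[of a "- a"] by (simp add: eq_neg_iff_add_eq_0 add.commute)

lemma to_complex_diff: "to_complex (a - b) = to_complex a - to_complex b"
  using to_complex_add[of a "- b"] by (simp add: to_complex_minus)

lemma to_complex_of_real [simp]: "to_complex (of_real r) = of_real r"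
  by (simp add: of_real_def to_complex_scaleR to_complex_one)

text \<open>An additive norm-preserving map has trivial kernel. Identities between scalars can
  therefore be checked after mapping them to the complex numbers.\<close>

lemma to_complex_inject: "to_complex a = to_complex b \<longleftrightarrow> a = b"
  by (metis norm_to_complex norm_eq_zero right_minus_eq to_complex_diff)

lemmas to_complex_simps =
  to_complex_add to_complex_mult to_complex_one to_complex_minus to_complex_diff

text \<open>Both possible ranges, the reals and all complex numbers, are closed under
  conjugation.\<close>

lemma ex_conjugate:
  fixes a :: "'k::real_or_complex"
  shows "\<exists>b::'k. to_complex b = cnj (to_complex a)"
proof -
  have "cnj (to_complex a) \<in> range (to_complex :: 'k \<Rightarrow> complex)"
    using range_to_complex[where 'a = 'k]
  proof
    assume real: "range (to_complex :: 'k \<Rightarrow> complex) = \<real>"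
    then have "to_complex a \<in> \<real>"
      by blast
    with real show ?thesis
      by (simp add: Reals_cnj_iff)
  qed simp
  then show ?thesis
    by (metis imageE)
qed

text \<open>The class carries no conjugation of its own, so a preimage is chosen. It serves to build
  a concrete inner product over an arbitrary scalar field.\<close>

definition conjugate :: "'k::real_or_complex \<Rightarrow> 'k"
  where "conjugate a = (SOME b. to_complex b = cnj (to_complex a))"

lemma to_complex_conjugate: "to_complex (conjugate a) = cnj (to_complex a)"
  unfolding conjugate_def by (rule someI_ex) (rule ex_conjugate)

context inner_product_space
begin

lemma ip_diff_left: "ip (x - y) z = ip x z - ip y z"
  using ip_add_left[of "x - y" y z] by simp

lemma to_complex_ip_add_right:
  "to_complex (ip x (y + z)) = to_complex (ip x y) + to_complex (ip x z)"
  by (metis conj_sym ip_add_left to_complex_add complex_cnj_add)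

lemma to_complex_ip_diff_right:
  "to_complex (ip x (y - z)) = to_complex (ip x y) - to_complex (ip x z)"
  by (metis conj_sym ip_diff_left to_complex_diff complex_cnj_diff)

lemma to_complex_ip_scale_right:
  "to_complex (ip x (scale a y)) = cnj (to_complex a) * to_complex (ip x y)"
  by (metis conj_sym ip_scale_left to_complex_mult complex_cnj_mult)

lemmas to_complex_ip_simps =
  ip_add_left ip_diff_left ip_scale_left to_complex_simps
  to_complex_ip_add_right to_complex_ip_diff_right to_complex_ip_scale_right

lemma ip_self: "to_complex (ip x x) = of_real (re (ip x x))"
  by (metis Reals_cnj_iff conj_sym of_real_Re)

lemma re_ip_sym: "re (ip y x) = re (ip x y)"
  by (simp add: conj_sym[of x y])

lemma ip_norm_power2: "(ip_norm ip x)\<^sup>2 = re (ip x x)"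
  by (simp add: ip_norm_def ip_nonneg)

lemma ip_unit:
  assumes "ip_norm ip e = 1"
  shows "ip e e = 1"
  using ip_self[of e] ip_norm_power2[of e] assms
  by (metis of_real_1 one_power2 to_complex_inject to_complex_one)

text \<open>The cross terms cancel because the real part of the inner product is symmetric.\<close>

lemma re_ip_diff_add:
  "re (ip (d - w) (w + d)) = re (ip d d) - re (ip w w)"
  by (simp add: to_complex_ip_simps re_ip_sym[of w d])

text \<open>Expanding gives three correction terms, each \<open>ip x e * ip e y\<close> up to sign;
  two are subtracted and one is added.\<close>

lemma ip_orthogonal_parts:
  assumes "ip e e = 1"
  shows "ip (x - scale (ip x e) e) (y - scale (ip y e) e) = ip x y - ip x e * ip e y"
proof -
  have "to_complex (ip (x - scale (ip x e) e) (y - scale (ip y e) e))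
      = to_complex (ip x y - ip x e * ip e y)"
    by (simp add: to_complex_ip_simps assms conj_sym[of y e] algebra_simps)
  then show ?thesis
    by (simp only: to_complex_inject)
qed

lemma re_ip_orthogonal_part_le:
  assumes "ip e e = 1"
  shows "re (ip (x - scale (ip x e) e) (x - scale (ip x e) e)) \<le> re (ip x x)"
  unfolding ip_orthogonal_parts[OF assms]
  \<comment> \<open>The left side is now the real part of \<open>ip x x\<close> minus the squared
    modulus of \<open>ip x e\<close>.\<close>
  by (simp add: to_complex_simps conj_sym[of x e])

lemma orthogonal_part_translate:
  assumes "ip e e = 1"
  shows "(x - scale c e) - scale (ip (x - scale c e) e) e = x - scale (ip x e) e"
  by (simp add: ip_diff_left ip_scale_left assms scale_left_diff_distrib)

lemma re_ip_convex_combination: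
  "4 * t * (1 - t) * re (ip x y)
    \<le> re (ip (scale (of_real t) x + scale (of_real (1 - t)) y)
             (scale (of_real t) x + scale (of_real (1 - t)) y))"
proof -
  have "0 \<le> re (ip (scale (of_real t) x - scale (of_real (1 - t)) y)
                    (scale (of_real t) x - scale (of_real (1 - t)) y))"
    by (rule ip_nonneg)
  then show ?thesis
    by (simp add: to_complex_ip_simps re_ip_sym[of y x] algebra_simps)
qed

text \<open>With midpoint \<open>c\<close>, half-difference \<open>d\<close> and w = m - c e, the
  two arguments are d e - w and w + d e, so the cross terms drop out. This identity yields both the
  equivalence of the two hypotheses and the norm bound used in the main estimate.\<close>

lemma re_ip_diff_diff_eq:
  assumes "ip_norm ip e = 1"
  shows "re (ip (scale \<Gamma> e - m) (m - scale \<gamma> e))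
    = (1 / 2 * norm (\<Gamma> - \<gamma>))\<^sup>2 - (ip_norm ip (m - scale ((\<gamma> + \<Gamma>) / 2) e))\<^sup>2"
proof -
  define d where "d = (\<Gamma> - \<gamma>) / 2"
  define c where "c = (\<gamma> + \<Gamma>) / 2"
  have \<Gamma>: "\<Gamma> = c + d" and \<gamma>: "\<gamma> = c - d"
    by (simp_all add: c_def d_def field_simps)
  have "re (ip (scale d e) (scale d e)) = (norm d)\<^sup>2"
    unfolding norm_to_complex[symmetric, of d] cmod_power2
    by (simp add: to_complex_ip_simps ip_unit[OF assms] power2_eq_square)
  moreover have "norm d = 1 / 2 * norm (\<Gamma> - \<gamma>)"
    by (simp add: d_def norm_divide)
  moreover have "scale \<Gamma> e - m = scale d e - (m - scale c e)"
    and "m - scale \<gamma> e = (m - scale c e) + scale d e"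
    by (simp_all add: \<Gamma> \<gamma> scale_left_distrib scale_left_diff_distrib)
  ultimately show ?thesis
    by (simp only: re_ip_diff_add ip_norm_power2 flip: c_def)
qed

lemma re_ip_diff_diff_nonneg_iff:
  assumes "ip_norm ip e = 1"
  shows "0 \<le> re (ip (scale \<Gamma> e - m) (m - scale \<gamma> e))
    \<longleftrightarrow> ip_norm ip (m - scale ((\<gamma> + \<Gamma>) / 2) e) \<le> 1 / 2 * norm (\<Gamma> - \<gamma>)"
proof -
  \<comment> \<open>Comparing the squares amounts to comparing the norms only once both are known to
    be nonnegative.\<close>
  have "0 \<le> ip_norm ip (m - scale ((\<gamma> + \<Gamma>) / 2) e)"
    by (simp add: ip_norm_def ip_nonneg)
  then show ?thesis
    unfolding re_ip_diff_diff_eq[OF assms] diff_ge_0_iff_ge by (intro power_mono_iff) simp_all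
qed

lemma gruess_convex_combination:
  assumes e: "ip_norm ip e = 1" and t: "0 < t" "t < 1"
    and m: "m = scale (of_real t) x + scale (of_real (1 - t)) y"
    and nonneg: "0 \<le> re (ip (scale \<Gamma> e - m) (m - scale \<gamma> e))"
  shows "re (ip x y - ip x e * ip e y) \<le> 1 / 16 * (1 / (t * (1 - t))) * (norm (\<Gamma> - \<gamma>))\<^sup>2"
proof -
  note unit = ip_unit[OF e]
  define P where "P u = u - scale (ip u e) e" for u
  define c where "c = (\<gamma> + \<Gamma>) / 2"
  have "P m = scale (of_real t) (P x) + scale (of_real (1 - t)) (P y)"
    \<comment> \<open>Keeping \<open>of_real (1 - t)\<close> unsplit leaves the shape that
      \<open>re_ip_convex_combination\<close> expects.\<close>
    by (simp add: P_def m ip_add_left ip_scale_left scale_left_distrib scale_right_diff_distrib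
        del: of_real_diff)
  then have "4 * t * (1 - t) * re (ip (P x) (P y)) \<le> re (ip (P m) (P m))"
    by (simp only: re_ip_convex_combination)
  also have "P m = P (m - scale c e)"
    by (simp add: P_def orthogonal_part_translate[OF unit])
  also have "re (ip (P (m - scale c e)) (P (m - scale c e))) \<le> re (ip (m - scale c e) (m - scale c e))"
    unfolding P_def by (rule re_ip_orthogonal_part_le[OF unit])
  also have "\<dots> \<le> (1 / 2 * norm (\<Gamma> - \<gamma>))\<^sup>2"
    using nonneg unfolding re_ip_diff_diff_eq[OF e] ip_norm_power2 c_def by simp
  finally have "4 * t * (1 - t) * re (ip x y - ip x e * ip e y) \<le> (norm (\<Gamma> - \<gamma>))\<^sup>2 / 4"
    by (simp add: P_def ip_orthogonal_parts[OF unit] power_divide)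
  \<comment> \<open>Dividing by 4 t (1 - t) > 0 turns the factor 1/4, the square of the half in the
    radius, into 1/16.\<close>
  then show ?thesis
    using t by (simp add: field_simps)
qed

end

text \<open>The standard plane over K, built for a generic K so that one extremal example covers the
  real and the complex case.\<close>

definition pair_scale :: "'k::real_or_complex \<Rightarrow> 'k \<times> 'k \<Rightarrow> 'k \<times> 'k"
  where "pair_scale a u = (a * fst u, a * snd u)"

definition pair_ip :: "'k::real_or_complex \<times> 'k \<Rightarrow> 'k \<times> 'k \<Rightarrow> 'k"
  where "pair_ip u v = fst u * conjugate (fst v) + snd u * conjugate (snd v)"

lemma re_pair_ip_self: "re (pair_ip u u) = (norm (fst u))\<^sup>2 + (norm (snd u))\<^sup>2"
  unfolding norm_to_complex[symmetric, of "fst u"] norm_to_complex[symmetric, of "snd u"] cmod_power2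
  by (simp add: pair_ip_def to_complex_simps to_complex_conjugate power2_eq_square)

lemma inner_product_space_pair: "inner_product_space pair_scale pair_ip"
proof
  show "pair_ip u u = 0 \<longleftrightarrow> u = 0" for u :: "'a \<times> 'a"
  proof
    assume "pair_ip u u = 0"
    then have "(norm (fst u))\<^sup>2 + (norm (snd u))\<^sup>2 = 0"
      by (simp flip: re_pair_ip_self)
    then show "u = 0"
      by (simp add: sum_power2_eq_zero_iff prod_eq_iff)
  qed (simp add: pair_ip_def)
  show "to_complex (pair_ip v u) = cnj (to_complex (pair_ip u v))" for u v :: "'a \<times> 'a"
    by (simp add: pair_ip_def to_complex_simps to_complex_conjugate mult.commute)
  show "0 \<le> re (pair_ip u u)" for u :: "'a \<times> 'a"
    by (simp add: re_pair_ip_self)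
qed (simp_all add: pair_scale_def pair_ip_def prod_eq_iff algebra_simps)

text \<open>Validity is assumed only for structures on K x K, so the plane alone already forces the
  constant.\<close>

lemma gruess_constant_sharp:
  fixes C :: real
  assumes "\<And>(scale :: 'k \<Rightarrow> 'k \<times> 'k \<Rightarrow> 'k \<times> 'k) ip (\<gamma>::'k::real_or_complex) \<Gamma> e x y t.
      \<lbrakk>inner_product_space scale ip; ip_norm ip e = 1; 0 < t; t < 1;
        0 \<le> re (ip (scale \<Gamma> e - (scale (of_real t) x + scale (of_real (1 - t)) y))
                    ((scale (of_real t) x + scale (of_real (1 - t)) y) - scale \<gamma> e))\<rbrakk>
      \<Longrightarrow> re (ip x y - ip x e * ip e y) \<le> C * (1 / (t * (1 - t))) * (norm (\<Gamma> - \<gamma>))\<^sup>2"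
  shows "1 / 16 \<le> C"
proof -
  let ?e = "(1, 0) :: 'k \<times> 'k" and ?x = "(0, 1) :: 'k \<times> 'k"
  interpret inner_product_space "pair_scale :: 'k \<Rightarrow> _" pair_ip
    by (rule inner_product_space_pair)
  have e: "ip_norm pair_ip ?e = 1"
    by (simp add: ip_norm_def re_pair_ip_self)
  have half: "of_real (1 / 2) + of_real (1 - 1 / 2) = (1 :: 'k)"
    by (simp flip: of_real_add)
  \<comment> \<open>As x = y, the convex combination is x itself.\<close>
  have m: "pair_scale (of_real (1 / 2)) ?x + pair_scale (of_real (1 - 1 / 2)) ?x = ?x"
    unfolding scale_left_distrib[symmetric] half by simp
  have "norm (1 - (- 1) :: 'k) = 2"
    by simp
  \<comment> \<open>The midpoint of -1 and 1 is 0, so in norm form the condition reads 1 \<le>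
    1.\<close>
  then have "0 \<le> re (pair_ip (pair_scale 1 ?e - ?x) (?x - pair_scale (- 1) ?e))"
    unfolding re_ip_diff_diff_nonneg_iff[OF e] by (simp add: ip_norm_def re_pair_ip_self)
  then have "re (pair_ip ?x ?x - pair_ip ?x ?e * pair_ip ?e ?x)
      \<le> C * (1 / (1 / 2 * (1 - 1 / 2))) * (norm (1 - (- 1) :: 'k))\<^sup>2"
    using assms[OF inner_product_space_pair e, of "1 / 2" 1 ?x ?x "- 1"] m by simp
  moreover have "pair_ip ?x ?e = 0"
    unfolding to_complex_inject[symmetric, where 'a = 'k]
    by (simp add: pair_ip_def to_complex_simps to_complex_conjugate)
  moreover have "re (pair_ip ?x ?x) = 1"
    by (simp add: re_pair_ip_self)
  \<comment> \<open>The assumed bound has become 1 \<le> C * 4 * 4.\<close>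
  ultimately show ?thesis
    by simp
qed

theorem theorem3:
  "(\<forall>(scale :: 'k::real_or_complex \<Rightarrow> 'a::ab_group_add \<Rightarrow> 'a) (ip :: 'a \<Rightarrow> 'a \<Rightarrow> 'k)
      (\<gamma>::'k) (\<Gamma>::'k) (e::'a) (x::'a) (y::'a) (t::real).
      inner_product_space scale ip \<longrightarrow> ip_norm ip e = 1 \<longrightarrow> 0 < t \<longrightarrow> t < 1 \<longrightarrow>
        (0 \<le> re (ip (scale \<Gamma> e - (scale (of_real t) x + scale (of_real (1 - t)) y))
                    ((scale (of_real t) x + scale (of_real (1 - t)) y) - scale \<gamma> e))
          \<longleftrightarrow> ip_norm ip (scale (of_real t) x + scale (of_real (1 - t)) y
                         - scale ((\<gamma> + \<Gamma>) / 2) e) \<le> 1 / 2 * norm (\<Gamma> - \<gamma>)) \<and>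
        (0 \<le> re (ip (scale \<Gamma> e - (scale (of_real t) x + scale (of_real (1 - t)) y))
                    ((scale (of_real t) x + scale (of_real (1 - t)) y) - scale \<gamma> e))
          \<longrightarrow> re (ip x y - ip x e * ip e y)
              \<le> 1 / 16 * (1 / (t * (1 - t))) * (norm (\<Gamma> - \<gamma>))\<^sup>2)) \<and>
   (\<forall>C::real.
      (\<forall>(scale :: 'k \<Rightarrow> 'k \<times> 'k \<Rightarrow> 'k \<times> 'k) (ip :: 'k \<times> 'k \<Rightarrow> 'k \<times> 'k \<Rightarrow> 'k)
         (\<gamma>::'k) (\<Gamma>::'k) (e::'k \<times> 'k) (x::'k \<times> 'k) (y::'k \<times> 'k) (t::real).
         inner_product_space scale ip \<longrightarrow> ip_norm ip e = 1 \<longrightarrow> 0 < t \<longrightarrow> t < 1 \<longrightarrow>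
           0 \<le> re (ip (scale \<Gamma> e - (scale (of_real t) x + scale (of_real (1 - t)) y))
                      ((scale (of_real t) x + scale (of_real (1 - t)) y) - scale \<gamma> e)) \<longrightarrow>
           re (ip x y - ip x e * ip e y)
             \<le> C * (1 / (t * (1 - t))) * (norm (\<Gamma> - \<gamma>))\<^sup>2)
      \<longrightarrow> 1 / 16 \<le> C)"
proof (intro conjI allI impI, goal_cases)
  case (1 scale ip \<gamma> \<Gamma> e x y t)
  then interpret inner_product_space scale ip by simp
  show ?case by (rule re_ip_diff_diff_nonneg_iff) fact
next
  case (2 scale ip \<gamma> \<Gamma> e x y t)
  then interpret inner_product_space scale ip by simp
  show ?case by (rule gruess_convex_combination[OF _ _ _ refl]) fact+
next
  case (3 C)
  show ?case by (rule gruess_constant_sharp[where 'k = 'k]) (use 3 in blast)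
qed

end
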